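(* With the polynomials $Q_{n,k}^{(a,b,c)}$, $a,b,c\in\{0,1\}$, defined in the context, the following identities of polynomials in $(x,y)$ hold. (1) From $(1,1,0)$ to $(1,0,0)$: $Q_{0,0}^{(1,1,0)}=Q_{0,0}^{(1,0,0)}$; $2n\,Q_{n,0}^{(1,1,0)}=(n+1)Q_{n,0}^{(1,0,0)}-n\,Q_{n-1,0}^{(1,0,0)}$ for $n\ge1$; $4n\,Q_{n,k}^{(1,1,0)}=(n+k+1)Q_{n,k}^{(1,0,0)}-(n-k)Q_{n,k-1}^{(1,0,0)}+(k-n)Q_{n-1,k}^{(1,0,0)}+(n+k-1)Q_{n-1,k-1}^{(1,0,0)}$ for $1\le k\le n-1$; $2Q_{n,n}^{(1,1,0)}=Q_{n,n}^{(1,0,0)}-Q_{n,n-1}^{(1,0,0)}+Q_{n-1,n-1}^{(1,0,0)}$ for $n\ge1$. (2) From $(1,1,0)$ to $(0,1,0)$: $2Q_{n,0}^{(1,1,0)}=Q_{n,0}^{(0,1,0)}+Q_{n-1,0}^{(0,1,0)}$ for $n\ge1$; $2n\,Q_{n,k}^{(1,1,0)}=(n-k)\left[Q_{n,k}^{(0,1,0)}+Q_{n-1,k}^{(0,1,0)}\right]$ for $1\le k\le n-1$; $Q_{n,n}^{(1,1,0)}=Q_{n,n}^{(0,1,0)}$. (3) From $(1,0,1)$ to $(1,0,0)$: $Q_{0,0}^{(1,0,1)}=Q_{0,0}^{(1,0,0)}$; $2n\,Q_{n,0}^{(1,0,1)}=(n+1)Q_{n,0}^{(1,0,0)}-n\,Q_{n-1,0}^{(1,0,0)}$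 for $n\ge1$; $4n\,Q_{n,k}^{(1,0,1)}=-(n+k+1)Q_{n,k}^{(1,0,0)}-(n-k)Q_{n,k-1}^{(1,0,0)}+(n-k)Q_{n-1,k}^{(1,0,0)}+(n+k-1)Q_{n-1,k-1}^{(1,0,0)}$ for $1\le k\le n-1$; $2Q_{n,n}^{(1,0,1)}=-Q_{n,n}^{(1,0,0)}-Q_{n,n-1}^{(1,0,0)}+Q_{n-1,n-1}^{(1,0,0)}$ for $n\ge1$. (4) From $(1,0,1)$ to $(0,0,1)$: $2Q_{n,0}^{(1,0,1)}=Q_{n,0}^{(0,0,1)}+Q_{n-1,0}^{(0,0,1)}$ for $n\ge1$; $2n\,Q_{n,k}^{(1,0,1)}=(n-k)\left[Q_{n,k}^{(0,0,1)}+Q_{n-1,k}^{(0,0,1)}\right]$ for $1\le k\le n-1$; $Q_{n,n}^{(1,0,1)}=Q_{n,n}^{(0,0,1)}$. (5) From $(0,1,1)$ to $(0,1,0)$: $2Q_{n,0}^{(0,1,1)}=-Q_{n,0}^{(0,1,0)}+Q_{n-1,0}^{(0,1,0)}$ for $n\ge1$; $2n\,Q_{n,1}^{(0,1,1)}=-2(n+1)Q_{n,1}^{(0,1,0)}-n\,Q_{n,0}^{(0,1,0)}+2(n-1)Q_{n-1,1}^{(0,1,0)}+n\,Q_{n-1,0}^{(0,1,0)}$ for $n\ge1$; $2n(2k-1)Q_{n,k}^{(0,1,1)}=-(k-1)(n+k)Q_{n,k}^{(0,1,0)}-(k-1)(n-k+1)Q_{n,k-1}^{(0,1,0)}+(k-1)(n-k)Q_{n-1,k}^{(0,1,0)}+(k-1)(n+k-1)Q_{n-1,k-1}^{(0,1,0)}$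 for $2\le k\le n$. (6) From $(0,1,1)$ to $(0,0,1)$: $2Q_{n,0}^{(0,1,1)}=-Q_{n,0}^{(0,0,1)}+Q_{n-1,0}^{(0,0,1)}$ for $n\ge1$; $2n\,Q_{n,1}^{(0,1,1)}=2(n+1)Q_{n,1}^{(0,0,1)}+n\,Q_{n,0}^{(0,0,1)}-2(n-1)Q_{n-1,1}^{(0,0,1)}-n\,Q_{n-1,0}^{(0,0,1)}$ for $n\ge1$; $2n(2k-1)Q_{n,k}^{(0,1,1)}=(k-1)(n+k)Q_{n,k}^{(0,0,1)}-(k-1)(n-k+1)Q_{n,k-1}^{(0,0,1)}-(k-1)(n-k)Q_{n-1,k}^{(0,0,1)}+(k-1)(n+k-1)Q_{n-1,k-1}^{(0,0,1)}$ for $2\le k\le n$. (Terms with zero coefficient whose polynomial has second index larger than the first are read as zero.)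
   Context: Let $P_k^{(\alpha,\beta)}$ denote the classical degree-$k$ Jacobi polynomial on $[-1,1]$ (standard normalization $P_k^{(\alpha,\beta)}(1)=\binom{k+\alpha}{k}$), and let $\tilde P_k^{(\alpha,\beta)}(x)=P_k^{(\alpha,\beta)}(2x-1)$ be the shifted Jacobi polynomial on $[0,1]$. For $a,b,c>-1$ and integers $n\ge k\ge 0$ the Jacobi polynomials on the triangle are $$P_{n,k}^{(a,b,c)}(x,y)=\tilde P_{n-k}^{(2k+b+c+1,a)}(x)\,(1-x)^k\,\tilde P_k^{(c,b)}\!\left(\tfrac{y}{1-x}\right),$$ and $P_{n,k}:=P_{n,k}^{(0,0,0)}$. These are polynomials in $x,y$. Put $z:=1-x-y$. One-edge Dirichlet bases: - $Q_{0,0}^{(1,0,0)}:=1$; $Q_{n,k}^{(1,0,0)}:=x\,P_{n-1,k}^{(1,0,0)}$ for $0\le k\le n-1$; $Q_{n,n}^{(1,0,0)}:=P_{n,n}$. - $Q_{n,0}^{(0,1,0)}(x,y):=\tilde P_n^{(0,0)}(x)$; $Q_{n,k}^{(0,1,0)}:=y\,P_{n-1,k-1}^{(0,1,0)}$ for $1\le k\le n$. - $Q_{n,0}^{(0,0,1)}(x,y):=\tilde P_n^{(0,0)}(x)$; $Q_{n,k}^{(0,0,1)}:=z\,P_{n-1,k-1}^{(0,0,1)}$ for $1\le k\le n$. Two-edge Dirichlet bases (for $n\ge1$ in all lines except the $Q_{0,0}$ ones): - $Q_{0,0}^{(1,1,0)}:=1$; $Q_{n,0}^{(1,1,0)}:=x\,\tilde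 P_{n-1}^{(0,1)}(x)$; $Q_{n,k}^{(1,1,0)}:=xy\,P_{n-2,k-1}^{(1,1,0)}$ for $1\le k\le n-1$; $Q_{n,n}^{(1,1,0)}:=y\,P_{n-1,n-1}^{(0,1,0)}$. - $Q_{0,0}^{(1,0,1)}:=1$; $Q_{n,0}^{(1,0,1)}:=x\,\tilde P_{n-1}^{(0,1)}(x)$; $Q_{n,k}^{(1,0,1)}:=xz\,P_{n-2,k-1}^{(1,0,1)}$ for $1\le k\le n-1$; $Q_{n,n}^{(1,0,1)}:=z\,P_{n-1,n-1}^{(0,0,1)}$. - $Q_{0,0}^{(0,1,1)}:=1$; $Q_{n,0}^{(0,1,1)}:=(1-x)P_{n-1,0}=(1-x)\tilde P_{n-1}^{(1,0)}(x)$; $Q_{n,1}^{(0,1,1)}:=(1-x-2y)P_{n-1,0}=(1-x-2y)\tilde P_{n-1}^{(1,0)}(x)$; $Q_{n,k}^{(0,1,1)}:=yz\,P_{n-2,k-2}^{(0,1,1)}$ for $2\le k\le n$.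
   Formalization: In (1) and (3), the k=0 line fails at n=1 and the 1≤k≤n−1 line fails at k=n−1 as printed; there the term in Q_{n-1,k}^{(1,0,0)} (which equals P_{n-1,n-1}, not 0) is dropped, giving corrected identities; all else is as printed. *)

theory Defs
  imports Complex_Main "HOL-Computational_Algebra.Polynomial"
begin

text \<open>
  Jacobi polynomials are given by the explicit formula
  $P_k^{(\alpha,\beta)}(t)=\sum_{s\le k}\binom{k+\alpha}{k-s}\binom{k+\beta}{s}
    \bigl(\frac{t-1}{2}\bigr)^s\bigl(\frac{t+1}{2}\bigr)^{k-s}$
  (Szego, Orthogonal Polynomials, (4.3.2)).
\<close>

definition jacobi :: "nat \<Rightarrow> real \<Rightarrow> real \<Rightarrow> real poly" where
  "jacobi k \<alpha> \<beta> =
     (\<Sum>s\<le>k. smult (((real k + \<alpha>) gchoose (k - s)) * ((real k + \<beta>) gchoose s))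
              ([:-1/2, 1/2:] ^ s * [:1/2, 1/2:] ^ (k - s)))"

lemma jacobi_at_1: "poly (jacobi k \<alpha> \<beta>) 1 = (real k + \<alpha>) gchoose k"
proof -
  have "poly (jacobi k \<alpha> \<beta>) 1 =
      (\<Sum>s\<le>k. ((real k + \<alpha>) gchoose (k - s)) * ((real k + \<beta>) gchoose s) * 0 ^ s)"
    by (simp add: jacobi_def poly_sum mult.assoc)
  also have "\<dots> = (\<Sum>s\<le>k. if s = 0 then (real k + \<alpha>) gchoose k else 0)"
    by (intro sum.cong) (auto simp: power_0_left)
  also have "\<dots> = (real k + \<alpha>) gchoose k"
    by simp
  finally show ?thesis .
qed

definition shifted_jacobi :: "nat \<Rightarrow> real \<Rightarrow> real \<Rightarrow> real poly" where
  "shifted_jacobi k \<alpha> \<beta> = pcompose (jacobi k \<alpha> \<beta>) [:-1, 2:]"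

lemma poly_shifted_jacobi: "poly (shifted_jacobi k \<alpha> \<beta>) x = poly (jacobi k \<alpha> \<beta>) (2 * x - 1)"
  by (simp add: shifted_jacobi_def poly_pcompose algebra_simps)

lemma degree_jacobi_le: "degree (jacobi k \<alpha> \<beta>) \<le> k"
  unfolding jacobi_def
proof (rule degree_sum_le)
  fix s assume "s \<in> {..k}"
  have "degree ([:-1/2, 1/2::real:] ^ s * [:1/2, 1/2:] ^ (k - s)) \<le> s + (k - s)"
    by (intro order.trans[OF degree_mult_le] add_mono order.trans[OF degree_power_le]) simp_all
  then show "degree (smult (((real k + \<alpha>) gchoose (k - s)) * ((real k + \<beta>) gchoose s))
      ([:-1/2, 1/2:] ^ s * [:1/2, 1/2:] ^ (k - s))) \<le> k"
    using \<open>s \<in> {..k}\<close> by (intro order.trans[OF degree_smult_le]) simp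
qed simp

lemma degree_shifted_jacobi_le: "degree (shifted_jacobi k \<alpha> \<beta>) \<le> k"
  using degree_jacobi_le[of k \<alpha> \<beta>] by (simp add: shifted_jacobi_def degree_pcompose)

text \<open>
  Bivariate polynomials in $(x,y)$ have type \<^typ>\<open>real poly poly\<close>: the inner variable is
  $x$ and the outer one is $y$.
\<close>

definition pX :: "real poly poly" where
  "pX = [:[:0, 1:]:]"

definition pY :: "real poly poly" where
  "pY = [:0, 1:]"

definition pZ :: "real poly poly" where
  "pZ = 1 - pX - pY"

definition in_x :: "real poly \<Rightarrow> real poly poly" where
  "in_x p = [:p:]"

definition eval2 :: "real poly poly \<Rightarrow> real \<Rightarrow> real \<Rightarrow> real" where
  "eval2 p x y = poly (poly p [:y:]) x"

text \<open>
  The polynomial $(1-x)^k\,p\bigl(\frac{y}{1-x}\bigr)$, for \<^prop>\<open>degree p \<le> k\<close>; multiplied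
  out, because the quotient is not available at $x=1$.
\<close>

definition homog :: "nat \<Rightarrow> real poly \<Rightarrow> real poly poly" where
  "homog k p = (\<Sum>i\<le>k. in_x [:coeff p i:] * pY ^ i * (1 - pX) ^ (k - i))"

definition tri_P :: "real \<Rightarrow> real \<Rightarrow> real \<Rightarrow> nat \<Rightarrow> nat \<Rightarrow> real poly poly" where
  "tri_P a b c n k =
     in_x (shifted_jacobi (n - k) (2 * real k + b + c + 1) a) * homog k (shifted_jacobi k c b)"

lemma eval2_homog:
  assumes "degree p \<le> k" "x \<noteq> 1"
  shows "eval2 (homog k p) x y = (1 - x) ^ k * poly p (y / (1 - x))"
proof -
  have "eval2 (homog k p) x y = (\<Sum>i\<le>k. coeff p i * y ^ i * (1 - x) ^ (k - i))"
    by (simp add: eval2_def homog_def in_x_def pX_def pY_def poly_sum mult.assoc)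
  also have "\<dots> = (\<Sum>i\<le>k. (1 - x) ^ k * (coeff p i * (y / (1 - x)) ^ i))"
    using assms(2) by (intro sum.cong) (auto simp: power_diff power_divide)
  also have "\<dots> = (1 - x) ^ k * poly p (y / (1 - x))"
    unfolding poly_altdef sum_distrib_left using assms(1)
    by (intro sum.mono_neutral_right) (auto simp: coeff_eq_0)
  finally show ?thesis .
qed

lemma eval2_tri_P:
  assumes "x \<noteq> 1"
  shows "eval2 (tri_P a b c n k) x y =
    poly (shifted_jacobi (n - k) (2 * real k + b + c + 1) a) x *
    (1 - x) ^ k * poly (shifted_jacobi k c b) (y / (1 - x))"
proof -
  have "eval2 (tri_P a b c n k) x y =
      poly (shifted_jacobi (n - k) (2 * real k + b + c + 1) a) x *
      eval2 (homog k (shifted_jacobi k c b)) x y"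
    by (simp add: tri_P_def eval2_def in_x_def)
  then show ?thesis
    using eval2_homog[OF degree_shifted_jacobi_le assms] by simp
qed

definition Q100 :: "nat \<Rightarrow> nat \<Rightarrow> real poly poly" where
  "Q100 n k =
     (if k > n then 0
      else if n = 0 then 1
      else if k = n then tri_P 0 0 0 n n
      else pX * tri_P 1 0 0 (n - 1) k)"

definition Q010 :: "nat \<Rightarrow> nat \<Rightarrow> real poly poly" where
  "Q010 n k =
     (if k > n then 0
      else if k = 0 then in_x (shifted_jacobi n 0 0)
      else pY * tri_P 0 1 0 (n - 1) (k - 1))"

definition Q001 :: "nat \<Rightarrow> nat \<Rightarrow> real poly poly" where
  "Q001 n k =
     (if k > n then 0
      else if k = 0 then in_x (shifted_jacobi n 0 0)
      else pZ * tri_P 0 0 1 (n - 1) (k - 1))"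

definition Q110 :: "nat \<Rightarrow> nat \<Rightarrow> real poly poly" where
  "Q110 n k =
     (if k > n then 0
      else if n = 0 then 1
      else if k = 0 then pX * in_x (shifted_jacobi (n - 1) 0 1)
      else if k = n then pY * tri_P 0 1 0 (n - 1) (n - 1)
      else pX * pY * tri_P 1 1 0 (n - 2) (k - 1))"

definition Q101 :: "nat \<Rightarrow> nat \<Rightarrow> real poly poly" where
  "Q101 n k =
     (if k > n then 0
      else if n = 0 then 1
      else if k = 0 then pX * in_x (shifted_jacobi (n - 1) 0 1)
      else if k = n then pZ * tri_P 0 0 1 (n - 1) (n - 1)
      else pX * pZ * tri_P 1 0 1 (n - 2) (k - 1))"

definition Q011 :: "nat \<Rightarrow> nat \<Rightarrow> real poly poly" where
  "Q011 n k =
     (if k > n then 0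
      else if n = 0 then 1
      else if k = 0 then (1 - pX) * tri_P 0 0 0 (n - 1) 0
      else if k = 1 then (1 - pX - 2 * pY) * tri_P 0 0 0 (n - 1) 0
      else pY * pZ * tri_P 0 1 1 (n - 2) (k - 2))"

lemma tri_P_0: "tri_P 0 0 0 n 0 = in_x (shifted_jacobi n 1 0)"
  by (simp add: tri_P_def homog_def shifted_jacobi_def jacobi_def in_x_def pcompose_1 one_pCons)

text \<open>
  Rewriting the basis $(1,1,0)$ or $(1,0,1)$ in the basis $(1,0,0)$, the four-term relation for
  $Q_{n,k}$, $1\le k\le n-2$, does not extend to $k=n-1$: its term in $Q_{n-1,k}$ comes from
  $x\,P_{n-2,k}^{(1,0,0)}$, which for $k=n-1$ is zero by the convention $P_{m,k}=0$ for $k>m$,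
  whereas $Q_{n-1,n-1}^{(1,0,0)}=P_{n-1,n-1}$.  The two-term relation for $Q_{n,0}$ does not extend
  to $n=1$ for the same reason.
\<close>

lemma four_term_relation_fails:
  assumes "n \<ge> 2"
  defines "k \<equiv> n - 1"
  shows "4 * of_nat n * Q110 n k \<noteq>
      (of_nat n + of_nat k + 1) * Q100 n k - (of_nat n - of_nat k) * Q100 n (k - 1)
      + (of_nat k - of_nat n) * Q100 (n - 1) k
      + (of_nat n + of_nat k - 1) * Q100 (n - 1) (k - 1)" (is "?l1 \<noteq> ?r1")
    and "4 * of_nat n * Q101 n k \<noteq>
      - (of_nat n + of_nat k + 1) * Q100 n k - (of_nat n - of_nat k) * Q100 n (k - 1)
      + (of_nat n - of_nat k) * Q100 (n - 1) k
      + (of_nat n + of_nat k - 1) * Q100 (n - 1) (k - 1)" (is "?l2 \<noteq> ?r2")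
proof -
  have ev: "eval2 (p + q) 0 1 = eval2 p 0 1 + eval2 q 0 1"
    "eval2 (p - q) 0 1 = eval2 p 0 1 - eval2 q 0 1"
    "eval2 (- p) 0 1 = - eval2 p 0 1"
    "eval2 (p * q) 0 1 = eval2 p 0 1 * eval2 q 0 1"
    "eval2 (of_nat m) 0 1 = of_nat m" "eval2 1 0 1 = 1" "eval2 pX 0 1 = 0" for p q m
    by (simp_all add: eval2_def pX_def of_nat_poly)
  have "eval2 (tri_P 0 0 0 k k) 0 1 = 1"
    using jacobi_at_1[of k 0 0]
    by (simp add: eval2_tri_P poly_shifted_jacobi jacobi_def[of 0] flip: binomial_gbinomial)
  moreover have "k \<noteq> 0" "k < n" "real n - real k = 1" "n - Suc 0 = k" "k - Suc 0 < k"
    using assms by auto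
  ultimately have "eval2 (Q110 n k) 0 1 = 0" "eval2 (Q101 n k) 0 1 = 0"
    "eval2 (Q100 n k) 0 1 = 0" "eval2 (Q100 n (k - 1)) 0 1 = 0" "eval2 (Q100 k k) 0 1 = 1"
    "eval2 (Q100 k (k - 1)) 0 1 = 0" "eval2 (of_nat n - of_nat k) 0 1 = 1"
    "eval2 (of_nat k - of_nat n) 0 1 = -1" "n - 1 = k"
    by (auto simp: Q100_def Q110_def Q101_def ev)
  then have "eval2 ?l1 0 1 = 0" "eval2 ?r1 0 1 = -1" "eval2 ?l2 0 1 = 0" "eval2 ?r2 0 1 = 1"
    by (simp_all add: ev)
  then show "?l1 \<noteq> ?r1" "?l2 \<noteq> ?r2"
    by (metis zero_neq_neg_one zero_neq_one)+
qed

lemma two_term_relation_fails: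
  shows "2 * Q110 1 0 \<noteq> 2 * Q100 1 0 - 1 * Q100 0 0"
    and "2 * Q101 1 0 \<noteq> 2 * Q100 1 0 - 1 * Q100 0 0"
  by (simp_all add: Q110_def Q101_def Q100_def tri_P_def homog_def shifted_jacobi_def jacobi_def
      in_x_def one_pCons)

end

theory Submission
  imports Defs
begin

text \<open>
  On the lines $y=(1-x)w$ every basis polynomial becomes a Jacobi polynomial in $x$ times a power
  of $1-x$ times a Jacobi polynomial in $w$, so the identities reduce to three contiguous relations
  of $\tilde P_n^{(\alpha,\beta)}$: those expanding $x\tilde P_n^{(\alpha,\beta)}$ in
  $\tilde P^{(\alpha,\beta-1)}$, $(1-x)\tilde P_n^{(\alpha,\beta)}$ in $\tilde P^{(\alpha-1,\beta)}$
  and $\tilde P_n^{(\alpha,\beta)}$ in $\tilde P^{(\alpha+1,\beta)}$.  They hold coefficientwise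
  once the Jacobi polynomial is made homogeneous in $u=x$ and $v=x-1$ by means of $u-v=1$.
\<close>


section \<open>Homogeneous Jacobi polynomials and their contiguous relations\<close>

definition hom_jacobi :: "nat \<Rightarrow> real \<Rightarrow> real \<Rightarrow> real \<Rightarrow> real \<Rightarrow> real" where
  "hom_jacobi k \<alpha> \<beta> u v =
     (\<Sum>s\<le>k. ((real k + \<alpha>) gchoose (k - s)) * ((real k + \<beta>) gchoose s) * (v ^ s * u ^ (k - s)))"

lemma poly_shifted_jacobi_eq_hom:
  "poly (shifted_jacobi k \<alpha> \<beta>) x = hom_jacobi k \<alpha> \<beta> x (x - 1)"
proof -
  have "poly [:-1/2, 1/2:] (2 * x - 1) = x - 1" "poly [:1/2, 1/2:] (2 * x - 1) = x"
    by (simp_all add: field_simps)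
  then show ?thesis
    unfolding poly_shifted_jacobi jacobi_def hom_jacobi_def poly_sum poly_smult poly_mult poly_power
    by (simp only:)
qed

text \<open>Reversal of the summation order. This is the reflection symmetry of the Jacobi
  polynomials, and the homogeneous form keeps it free of signs.\<close>

lemma hom_jacobi_swap: "hom_jacobi k \<alpha> \<beta> u v = hom_jacobi k \<beta> \<alpha> v u"
  unfolding hom_jacobi_def
  by (rule sum.reindex_bij_witness[where i = "\<lambda>s. k - s" and j = "\<lambda>s. k - s"]) auto

text \<open>Here and in the next lemma a product by \<open>u\<close> or \<open>v\<close> is put back
  on the monomials \<open>v ^ s * u ^ (Suc n - s)\<close>, with coefficient zero at the index left
  empty. All sums in a contiguous relation then run over the same range and can be compared term by
  term.\<close>

lemma hom_sum_mult_left: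
  fixes c :: "nat \<Rightarrow> real"
  shows "u * (\<Sum>s\<le>n. c s * (v ^ s * u ^ (n - s))) =
    (\<Sum>s\<le>Suc n. (if s \<le> n then c s else 0) * (v ^ s * u ^ (Suc n - s)))"
proof -
  have "u * (\<Sum>s\<le>n. c s * (v ^ s * u ^ (n - s))) = (\<Sum>s\<le>n. c s * (v ^ s * u ^ (Suc n - s)))"
    by (simp add: sum_distrib_left Suc_diff_le algebra_simps)
  also have "\<dots> = (\<Sum>s\<le>Suc n. (if s \<le> n then c s else 0) * (v ^ s * u ^ (Suc n - s)))"
    by (simp add: sum.atMost_Suc)
  finally show ?thesis .
qed

lemma hom_sum_mult_right:
  fixes c :: "nat \<Rightarrow> real"
  shows "v * (\<Sum>s\<le>n. c s * (v ^ s * u ^ (n - s))) =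
    (\<Sum>s\<le>Suc n. (if s = 0 then 0 else c (s - 1)) * (v ^ s * u ^ (Suc n - s)))"
  unfolding sum.atMost_Suc_shift by (simp add: sum_distrib_left algebra_simps)

lemma gchoose_mult_absorb:
  fixes a :: real
  shows "(a + 1) * (a gchoose s) = (a + 1 - real s) * ((a + 1) gchoose s)"
  using gbinomial_absorb_comp[of "a + 1" s] by simp

lemma gchoose_mult_absorb_Suc:
  fixes a :: real
  shows "(a + 1) * (if s = 0 then 0 else a gchoose (s - 1)) = real s * ((a + 1) gchoose s)"
  using gbinomial_absorption'[of s "a + 1"] by (cases s) (auto simp: gbinomial_absorption)

lemma gchoose_Pascal:
  fixes a :: real
  assumes "s \<le> Suc n"
  shows "(a + 1) gchoose (Suc n - s) =
    (if s \<le> n then a gchoose (n - s) else 0) + (a gchoose (Suc n - s))"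
proof (cases "s \<le> n")
  case True
  then show ?thesis
    by (simp add: Suc_diff_le gbinomial_Suc_Suc)
qed (use assms in \<open>auto simp: le_Suc_eq\<close>)

text \<open>Ratio of two neighbouring binomials with the same upper entry. At
  \<open>s = Suc n\<close> the left factor vanishes, in agreement with the padding on the
  right.\<close>

lemma gchoose_step_down:
  fixes a :: real
  assumes "s \<le> Suc n"
  shows "(real n + 1 - real s) * ((real n + a) gchoose (Suc n - s)) =
    (a + real s) * (if s \<le> n then (real n + a) gchoose (n - s) else 0)"
proof (cases "s \<le> n")
  case True
  then show ?thesis
    using gbinomial_mult_1[of "real n + a" "n - s"]
    by (simp add: Suc_diff_le of_nat_diff algebra_simps)
qed (use assms in \<open>auto simp: le_Suc_eq\<close>)

text \<open>The factor \<open>u - v\<close>, which equals 1 at \<open>u = x\<close>,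
  \<open>v = x - 1\<close>, gives every term degree \<open>n + 1\<close>. Both sides are then sums
  over the same monomials, and the coefficients agree by elementary binomial relations.\<close>

lemma hom_jacobi_mult_left:
  "(2 * real n + \<alpha> + \<beta> + 2) * u * hom_jacobi n \<alpha> (\<beta> + 1) u v =
    (real n + 1) * hom_jacobi (Suc n) \<alpha> \<beta> u v
    + (real n + \<beta> + 1) * (u - v) * hom_jacobi n \<alpha> \<beta> u v"
proof -
  \<comment> \<open>\<open>A s\<close> and \<open>A' s\<close> are the two summands in Pascal's rule
    for the \<alpha>-binomial of degree \<open>Suc n\<close>; \<open>B s\<close> is the
    \<beta>-binomial. Every coefficient that occurs reduces to these three.\<close>
  define A where "A s = (if s \<le> n then (real n + \<alpha>) gchoose (n - s) else 0)" for s
  define A' where "A' s = (real n + \<alpha>) gchoose (Suc n - s)" for s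
  define B where "B s = (real n + \<beta> + 1) gchoose s" for s
  let ?w = "\<lambda>s. v ^ s * u ^ (Suc n - s)"
  let ?b = "\<lambda>s. (if s = 0 then 0 else (real n + \<beta>) gchoose (s - 1))"
  have 1: "u * hom_jacobi n \<alpha> (\<beta> + 1) u v = (\<Sum>s\<le>Suc n. A s * B s * ?w s)"
    unfolding hom_jacobi_def hom_sum_mult_left
    by (intro sum.cong) (auto simp: A_def B_def add.assoc)
  have 2: "hom_jacobi (Suc n) \<alpha> \<beta> u v = (\<Sum>s\<le>Suc n. (A s + A' s) * B s * ?w s)"
    unfolding hom_jacobi_def
    by (intro sum.cong refl)
      (use gchoose_Pascal[of _ n "real n + \<alpha>"] in \<open>auto simp: A_def A'_def B_def add_ac\<close>)
  have 3: "u * hom_jacobi n \<alpha> \<beta> u v = (\<Sum>s\<le>Suc n. A s * ((real n + \<beta>) gchoose s) * ?w s)"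
    unfolding hom_jacobi_def hom_sum_mult_left
    by (intro sum.cong) (auto simp: A_def)
  have 4: "v * hom_jacobi n \<alpha> \<beta> u v = (\<Sum>s\<le>Suc n. A' s * ?b s * ?w s)"
    unfolding hom_jacobi_def hom_sum_mult_right
    by (intro sum.cong) (auto simp: A'_def)
  have "(2 * real n + \<alpha> + \<beta> + 2) * (A s * B s) =
      (real n + 1) * ((A s + A' s) * B s)
      + (real n + \<beta> + 1) * (A s * ((real n + \<beta>) gchoose s) - A' s * ?b s)" if "s \<le> Suc n" for s
  proof -
    \<comment> \<open>After the \<beta>-binomials are rewritten by \<open>B s\<close>,
      \<open>A' s\<close> occurs only with the factor n+1-s and so becomes (\<alpha>+s)
      \<open>A s\<close>. What remains is (n+1) + (\<alpha>+s) + (n+\<beta>+1-s) =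
      2n+\<alpha>+\<beta>+2.\<close>
    have "(real n + 1 - real s) * A' s = (\<alpha> + real s) * A s"
      using gchoose_step_down[OF that] by (simp add: A_def A'_def)
    moreover have "(real n + \<beta> + 1) * ((real n + \<beta>) gchoose s) = (real n + \<beta> + 1 - real s) * B s"
      unfolding B_def by (rule gchoose_mult_absorb)
    moreover have "(real n + \<beta> + 1) * ?b s = real s * B s"
      unfolding B_def by (rule gchoose_mult_absorb_Suc)
    ultimately show ?thesis
      by algebra
  qed
  then have "(\<Sum>s\<le>Suc n. (2 * real n + \<alpha> + \<beta> + 2) * (A s * B s) * ?w s) =
      (\<Sum>s\<le>Suc n. ((real n + 1) * ((A s + A' s) * B s)
      + (real n + \<beta> + 1) * (A s * ((real n + \<beta>) gchoose s) - A' s * ?b s)) * ?w s)"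
    by (intro sum.cong) auto
  also have "\<dots> = (real n + 1) * hom_jacobi (Suc n) \<alpha> \<beta> u v
    + (real n + \<beta> + 1) * (u * hom_jacobi n \<alpha> \<beta> u v - v * hom_jacobi n \<alpha> \<beta> u v)"
    unfolding 2 3 4 by (simp only: sum_distrib_left sum.distrib[symmetric]
      sum_subtractf[symmetric] distrib_right left_diff_distrib right_diff_distrib mult.assoc)
  also have "(\<Sum>s\<le>Suc n. (2 * real n + \<alpha> + \<beta> + 2) * (A s * B s) * ?w s) =
      (2 * real n + \<alpha> + \<beta> + 2) * (u * hom_jacobi n \<alpha> (\<beta> + 1) u v)"
    unfolding 1 by (simp only: sum_distrib_left mult.assoc)
  finally show ?thesis
    by (simp add: algebra_simps)
qed

text \<open>The same comparison, with Pascal's rule now linking \<alpha> to \<alpha>+1 at fixed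
  degree: \<open>A' s\<close> belongs to \<alpha> and \<open>A s + A' s\<close> to \<alpha>+1. This
  time \<open>A s\<close> is eliminated, and the coefficients agree because (n+1-s) +
  (n+\<alpha>+\<beta>+2+s) = 2n+\<alpha>+\<beta>+3.\<close>

lemma hom_jacobi_raise:
  "(2 * real n + \<alpha> + \<beta> + 3) * hom_jacobi (Suc n) \<alpha> \<beta> u v =
    (real n + \<alpha> + \<beta> + 2) * hom_jacobi (Suc n) (\<alpha> + 1) \<beta> u v
    - (real n + \<beta> + 1) * (u - v) * hom_jacobi n (\<alpha> + 1) \<beta> u v"
proof -
  define A where "A s = (if s \<le> n then (real n + (\<alpha> + 1)) gchoose (n - s) else 0)" for s
  define A' where "A' s = (real n + (\<alpha> + 1)) gchoose (Suc n - s)" for s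
  define B where "B s = (real n + \<beta> + 1) gchoose s" for s
  let ?w = "\<lambda>s. v ^ s * u ^ (Suc n - s)"
  let ?b = "\<lambda>s. (if s = 0 then 0 else (real n + \<beta>) gchoose (s - 1))"
  have 1: "hom_jacobi (Suc n) \<alpha> \<beta> u v = (\<Sum>s\<le>Suc n. A' s * B s * ?w s)"
    unfolding hom_jacobi_def
    by (intro sum.cong) (auto simp: A'_def B_def add_ac)
  have 2: "hom_jacobi (Suc n) (\<alpha> + 1) \<beta> u v = (\<Sum>s\<le>Suc n. (A s + A' s) * B s * ?w s)"
    unfolding hom_jacobi_def
    by (intro sum.cong refl)
      (use gchoose_Pascal[of _ n "real n + (\<alpha> + 1)"] in \<open>auto simp: A_def A'_def B_def add_ac\<close>)
  have 3: "u * hom_jacobi n (\<alpha> + 1) \<beta> u v = (\<Sum>s\<le>Suc n. A s * ((real n + \<beta>) gchoose s) * ?w s)"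
    unfolding hom_jacobi_def hom_sum_mult_left
    by (intro sum.cong) (auto simp: A_def)
  have 4: "v * hom_jacobi n (\<alpha> + 1) \<beta> u v = (\<Sum>s\<le>Suc n. A' s * ?b s * ?w s)"
    unfolding hom_jacobi_def hom_sum_mult_right
    by (intro sum.cong) (auto simp: A'_def)
  have "(2 * real n + \<alpha> + \<beta> + 3) * (A' s * B s) =
      (real n + \<alpha> + \<beta> + 2) * ((A s + A' s) * B s)
      - (real n + \<beta> + 1) * (A s * ((real n + \<beta>) gchoose s) - A' s * ?b s)" if "s \<le> Suc n" for s
  proof -
    have "(real n + 1 - real s) * A' s = (\<alpha> + 1 + real s) * A s"
      using gchoose_step_down[OF that] by (simp add: A_def A'_def)
    moreover have "(real n + \<beta> + 1) * ((real n + \<beta>) gchoose s) = (real n + \<beta> + 1 - real s) * B s"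
      unfolding B_def by (rule gchoose_mult_absorb)
    moreover have "(real n + \<beta> + 1) * ?b s = real s * B s"
      unfolding B_def by (rule gchoose_mult_absorb_Suc)
    ultimately show ?thesis
      by algebra
  qed
  then have "(\<Sum>s\<le>Suc n. (2 * real n + \<alpha> + \<beta> + 3) * (A' s * B s) * ?w s) =
      (\<Sum>s\<le>Suc n. ((real n + \<alpha> + \<beta> + 2) * ((A s + A' s) * B s)
      - (real n + \<beta> + 1) * (A s * ((real n + \<beta>) gchoose s) - A' s * ?b s)) * ?w s)"
    by (intro sum.cong) auto
  also have "\<dots> = (real n + \<alpha> + \<beta> + 2) * hom_jacobi (Suc n) (\<alpha> + 1) \<beta> u v
    - (real n + \<beta> + 1) * (u * hom_jacobi n (\<alpha> + 1) \<beta> u v - v * hom_jacobi n (\<alpha> + 1) \<beta> u v)"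
    unfolding 2 3 4 by (simp only: sum_distrib_left
      sum_subtractf[symmetric] left_diff_distrib right_diff_distrib mult.assoc)
  also have "(\<Sum>s\<le>Suc n. (2 * real n + \<alpha> + \<beta> + 3) * (A' s * B s) * ?w s) =
      (2 * real n + \<alpha> + \<beta> + 3) * hom_jacobi (Suc n) \<alpha> \<beta> u v"
    unfolding 1 by (simp only: sum_distrib_left mult.assoc)
  finally show ?thesis
    by (simp add: algebra_simps)
qed

section \<open>Contiguous relations of the shifted Jacobi polynomials\<close>

lemma shifted_jacobi_0 [simp]: "shifted_jacobi 0 \<alpha> \<beta> = 1"
  by (simp add: shifted_jacobi_def jacobi_def pcompose_1)

lemma shifted_jacobi_mult_x:
  "(2 * real n + \<alpha> + \<beta> + 1) * (x * poly (shifted_jacobi n \<alpha> \<beta>) x) =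
    (real n + 1) * poly (shifted_jacobi (Suc n) \<alpha> (\<beta> - 1)) x
    + (real n + \<beta>) * poly (shifted_jacobi n \<alpha> (\<beta> - 1)) x"
  using hom_jacobi_mult_left[of n \<alpha> "\<beta> - 1" x "x - 1"]
  by (simp add: poly_shifted_jacobi_eq_hom algebra_simps)

text \<open>The mirror image of the relation for x: parameters and variables are interchanged, so
  \<open>u = x - 1\<close> and \<open>v = x\<close>. There \<open>u - v\<close> is -1, which
  accounts for the minus sign.\<close>

lemma shifted_jacobi_mult_one_minus_x:
  "(2 * real n + \<alpha> + \<beta> + 1) * ((1 - x) * poly (shifted_jacobi n \<alpha> \<beta>) x) =
    (real n + \<alpha>) * poly (shifted_jacobi n (\<alpha> - 1) \<beta>) x
    - (real n + 1) * poly (shifted_jacobi (Suc n) (\<alpha> - 1) \<beta>) x"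
  using hom_jacobi_mult_left[of n \<beta> "\<alpha> - 1" "x - 1" x]
  by (simp add: poly_shifted_jacobi_eq_hom hom_jacobi_swap[of _ \<beta>] algebra_simps)

text \<open>The conditional stands for a polynomial of degree -1, read as zero; truncated
  subtraction alone would turn it into the constant 1.\<close>

lemma shifted_jacobi_raise:
  "(2 * real n + \<alpha> + \<beta> + 1) * poly (shifted_jacobi n \<alpha> \<beta>) x =
    (real n + \<alpha> + \<beta> + 1) * poly (shifted_jacobi n (\<alpha> + 1) \<beta>) x
    - (real n + \<beta>) * (if n = 0 then 0 else poly (shifted_jacobi (n - 1) (\<alpha> + 1) \<beta>) x)"
proof (cases n)
  case (Suc m)
  then show ?thesis
    using hom_jacobi_raise[of m \<alpha> \<beta> x "x - 1"]
    by (simp add: poly_shifted_jacobi_eq_hom algebra_simps)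
qed simp

section \<open>Equality of bivariate polynomials by evaluation\<close>

lemma eval2_simps [simp]:
  "eval2 (p + q) x y = eval2 p x y + eval2 q x y"
  "eval2 (p - q) x y = eval2 p x y - eval2 q x y"
  "eval2 (- p) x y = - eval2 p x y"
  "eval2 (p * q) x y = eval2 p x y * eval2 q x y"
  "eval2 (of_nat m) x y = of_nat m"
  "eval2 (numeral r) x y = numeral r"
  "eval2 1 x y = 1"
  "eval2 0 x y = 0"
  "eval2 pX x y = x"
  "eval2 pY x y = y"
  "eval2 pZ x y = 1 - x - y"
  "eval2 (in_x p') x y = poly p' x"
  by (simp_all add: eval2_def pX_def pY_def pZ_def in_x_def of_nat_poly numeral_poly)

text \<open>Every point with \<open>x \<noteq> 1\<close> lies on a line y = (1-x)w. For fixed y the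
  difference is a polynomial in x with infinitely many roots, hence zero; then \<open>p - q\<close>,
  as a polynomial over the domain \<open>real poly\<close>, has all constants \<open>[:y:]\<close>
  as roots and vanishes too.\<close>

lemma eval2_eqI:
  assumes "\<And>x w. x \<noteq> 1 \<Longrightarrow> eval2 p x ((1 - x) * w) = eval2 q x ((1 - x) * w)"
  shows "p = q"
proof -
  have "poly p [:y:] = poly q [:y:]" for y
  proof -
    have "poly (poly p [:y:] - poly q [:y:]) x = 0" if "x \<noteq> 1" for x
      using assms[OF that, of "y / (1 - x)"] that by (simp add: eval2_def)
    then have "- {1} \<subseteq> {x. poly (poly p [:y:] - poly q [:y:]) x = 0}"
      by blast
    moreover have "infinite (- {1::real})"
      by (simp add: infinite_UNIV_char_0)
    ultimately show ?thesis
      using poly_roots_finite finite_subset by (metis right_minus_eq)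
  qed
  then have "range (\<lambda>y. [:y:]) \<subseteq> {z. poly (p - q) z = 0}"
    by auto
  moreover have "infinite (range (\<lambda>y::real. [:y:]))"
    by (subst finite_image_iff) (auto simp: inj_on_def infinite_UNIV_char_0)
  ultimately show ?thesis
    using poly_roots_finite finite_subset by (metis right_minus_eq)
qed


section \<open>The basis polynomials in the coordinates x and w, where y = (1-x)w\<close>

context
  fixes x w :: real
  assumes x: "x \<noteq> 1"
begin

lemma eval2_tri_P_blowup:
  "eval2 (tri_P a b c n k) x ((1 - x) * w) =
    poly (shifted_jacobi (n - k) (2 * real k + b + c + 1) a) x *
    (1 - x) ^ k * poly (shifted_jacobi k c b) w"
  using x by (simp add: eval2_tri_P)

lemma blowup_factor [simp]:
  "1 - x - (1 - x) * w = (1 - x) * (1 - w)"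
  "1 - x - 2 * ((1 - x) * w) = (1 - x) * (1 - 2 * w)"
  by (simp_all add: algebra_simps)

text \<open>The first index is written as a sum with the degree \<open>m\<close> of the factor in x,
  so that no truncated subtraction is left and each line falls into one case of the
  definitions.\<close>

lemma eval2_Q_blowup:
  "eval2 (Q100 n n) x ((1 - x) * w) = (1 - x) ^ n * poly (shifted_jacobi n 0 0) w"
  "eval2 (Q100 (Suc (m + k)) k) x ((1 - x) * w) =
    x * poly (shifted_jacobi m (2 * real k + 1) 1) x * (1 - x) ^ k * poly (shifted_jacobi k 0 0) w"
  "eval2 (Q010 n 0) x ((1 - x) * w) = poly (shifted_jacobi n 0 0) x"
  "eval2 (Q010 (Suc (m + k)) (Suc k)) x ((1 - x) * w) =
    w * poly (shifted_jacobi m (2 * real k + 2) 0) x * (1 - x) ^ Suc k *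
    poly (shifted_jacobi k 0 1) w"
  "eval2 (Q001 n 0) x ((1 - x) * w) = poly (shifted_jacobi n 0 0) x"
  "eval2 (Q001 (Suc (m + k)) (Suc k)) x ((1 - x) * w) =
    (1 - w) * poly (shifted_jacobi m (2 * real k + 2) 0) x * (1 - x) ^ Suc k *
    poly (shifted_jacobi k 1 0) w"
  "eval2 (Q110 (Suc n) 0) x ((1 - x) * w) = x * poly (shifted_jacobi n 0 1) x"
  "eval2 (Q110 (Suc (Suc (m + k))) (Suc k)) x ((1 - x) * w) =
    x * w * poly (shifted_jacobi m (2 * real k + 2) 1) x * (1 - x) ^ Suc k *
    poly (shifted_jacobi k 0 1) w"
  "eval2 (Q110 (Suc n) (Suc n)) x ((1 - x) * w) =
    w * (1 - x) ^ Suc n * poly (shifted_jacobi n 0 1) w"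
  "eval2 (Q101 (Suc n) 0) x ((1 - x) * w) = x * poly (shifted_jacobi n 0 1) x"
  "eval2 (Q101 (Suc (Suc (m + k))) (Suc k)) x ((1 - x) * w) =
    x * (1 - w) * poly (shifted_jacobi m (2 * real k + 2) 1) x * (1 - x) ^ Suc k *
    poly (shifted_jacobi k 1 0) w"
  "eval2 (Q101 (Suc n) (Suc n)) x ((1 - x) * w) =
    (1 - w) * (1 - x) ^ Suc n * poly (shifted_jacobi n 1 0) w"
  "eval2 (Q011 (Suc n) 0) x ((1 - x) * w) = (1 - x) * poly (shifted_jacobi n 1 0) x"
  "eval2 (Q011 (Suc n) (Suc 0)) x ((1 - x) * w) =
    (1 - x) * (1 - 2 * w) * poly (shifted_jacobi n 1 0) x"
  "eval2 (Q011 (Suc (Suc (m + k))) (Suc (Suc k))) x ((1 - x) * w) =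
    w * (1 - w) * poly (shifted_jacobi m (2 * real k + 3) 0) x * (1 - x) ^ Suc (Suc k) *
    poly (shifted_jacobi k 1 1) w"
  by (auto simp: Q100_def Q010_def Q001_def Q110_def Q101_def Q011_def eval2_tri_P_blowup add.assoc)

end

section \<open>Relations for parameters 0 and 1, and the product of a relation in w with relations
  in x\<close>

lemma shifted_jacobi_0_1_mult_x:
  "2 * (x * poly (shifted_jacobi k 0 1) x) =
    poly (shifted_jacobi (Suc k) 0 0) x + poly (shifted_jacobi k 0 0) x"
proof -
  \<comment> \<open>For \<alpha> = 0 and \<beta> = 1 all three coefficients of the general relation
    are multiples of k+1, which is then cancelled.\<close>
  have "(real k + 1) * (2 * (x * poly (shifted_jacobi k 0 1) x)) =
      (real k + 1) * (poly (shifted_jacobi (Suc k) 0 0) x + poly (shifted_jacobi k 0 0) x)"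
    using shifted_jacobi_mult_x[of k 0 1 x] by (simp add: algebra_simps)
  then show ?thesis
    by (simp add: add_eq_0_iff)
qed

lemma shifted_jacobi_1_0_mult_one_minus_x:
  "2 * ((1 - x) * poly (shifted_jacobi k 1 0) x) =
    poly (shifted_jacobi k 0 0) x - poly (shifted_jacobi (Suc k) 0 0) x"
proof -
  have "(real k + 1) * (2 * ((1 - x) * poly (shifted_jacobi k 1 0) x)) =
      (real k + 1) * (poly (shifted_jacobi k 0 0) x - poly (shifted_jacobi (Suc k) 0 0) x)"
    using shifted_jacobi_mult_one_minus_x[of k 1 0 x] by (simp add: algebra_simps)
  then show ?thesis
    by (simp add: add_eq_0_iff)
qed

text \<open>
  Used with $f$ and $l$ the factors in $x$ and $w$ of the left-hand side and $y=1-x$; $p,q$ and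
  $p',q'$ are the factors in $x$ that accompany $g_1$ and $g_0$.
\<close>

lemma separated_four_term:
  fixes c d f l N s y :: real
  assumes "c * l = d * (g0 + s * g1)" "N * f = a * p - b * q" "N * (y * f) = a' * p' - b' * q'"
  shows "c * N * (f * y * l) = d * (s * (a * p - b * q) * y * g1 + (a' * p' - b' * q') * g0)"
proof -
  have "c * N * (f * y * l) = (c * l) * (N * f) * y"
    by simp
  also have "\<dots> = d * (s * (N * f) * y * g1 + (N * (y * f)) * g0)"
    unfolding assms(1) by (simp add: algebra_simps)
  finally show ?thesis
    unfolding assms(2,3) .
qed

section \<open>From (1,1,0) and (1,0,1) to (1,0,0)\<close>

lemma Q110_Q100_first:
  assumes "n \<ge> 2"
  shows "2 * of_nat n * Q110 n 0 = (of_nat n + 1) * Q100 n 0 - of_nat n * Q100 (n - 1) 0"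
    and "2 * of_nat n * Q101 n 0 = (of_nat n + 1) * Q100 n 0 - of_nat n * Q100 (n - 1) 0"
proof -
  \<comment> \<open>With n = m+2 both polynomials on the right have the form x times a Jacobi
    polynomial; at n = 1 the second would be \<open>Q100 0 0\<close>, the constant 1.\<close>
  define m where "m = n - 2"
  have n: "n = Suc (Suc m)"
    using assms by (simp add: m_def)
  have "2 * of_nat n * Q110 n 0 = (of_nat n + 1) * Q100 n 0 - of_nat n * Q100 (n - 1) 0"
  proof (rule eval2_eqI)
    fix x w :: real assume x: "x \<noteq> 1"
    note ev = eval2_Q_blowup(7)[OF x, of "Suc m" w]
      eval2_Q_blowup(2)[OF x, of m 0 w] eval2_Q_blowup(2)[OF x, of "Suc m" 0 w]
    show "eval2 (2 * of_nat n * Q110 n 0) x ((1 - x) * w) =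
        eval2 ((of_nat n + 1) * Q100 n 0 - of_nat n * Q100 (n - 1) 0) x ((1 - x) * w)"
      using arg_cong[OF shifted_jacobi_raise[of "Suc m" 0 1 x], of "\<lambda>t. x * t"] ev
      unfolding n by (simp add: algebra_simps)
  qed
  moreover have "Q101 n 0 = Q110 n 0"
    by (simp add: Q101_def Q110_def)
  ultimately show "2 * of_nat n * Q110 n 0 = (of_nat n + 1) * Q100 n 0 - of_nat n * Q100 (n - 1) 0"
    and "2 * of_nat n * Q101 n 0 = (of_nat n + 1) * Q100 n 0 - of_nat n * Q100 (n - 1) 0"
    by simp_all
qed

text \<open>The relation in x produces x times \<open>tri_P 1 0 0 (n - 2) k\<close>, which agrees
  with \<open>Q100 (n - 1) k\<close> only for k < n-1. At k = n-1 the term is absent, and the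
  conditional treats both ranges of k at once.\<close>

lemma Q110_Q100_inner:
  assumes "1 \<le> k" "k < n"
  shows "4 * of_nat n * Q110 n k =
      (of_nat n + of_nat k + 1) * Q100 n k - (of_nat n - of_nat k) * Q100 n (k - 1)
      + (of_nat k - of_nat n) * (if k + 1 = n then 0 else Q100 (n - 1) k)
      + (of_nat n + of_nat k - 1) * Q100 (n - 1) (k - 1)" (is "_ = ?r1")
    and "4 * of_nat n * Q101 n k =
      - (of_nat n + of_nat k + 1) * Q100 n k - (of_nat n - of_nat k) * Q100 n (k - 1)
      + (of_nat n - of_nat k) * (if k + 1 = n then 0 else Q100 (n - 1) k)
      + (of_nat n + of_nat k - 1) * Q100 (n - 1) (k - 1)" (is "_ = ?r2")
proof -
  define j m where "j = k - 1" "m = n - k - 1"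
  then have k: "k = Suc j" and n: "n = Suc (Suc (m + j))"
    using assms by simp_all
  have "eval2 (4 * of_nat n * Q110 n k) x y = eval2 ?r1 x y"
    "eval2 (4 * of_nat n * Q101 n k) x y = eval2 ?r2 x y"
    if x: "x \<noteq> 1" and y_def: "y = (1 - x) * w" for x y w
  proof -
    have evQ: "eval2 (Q110 n k) x y = x * w * poly (shifted_jacobi m (2 * real j + 2) 1) x *
        ((1 - x) * (1 - x) ^ j) * poly (shifted_jacobi j 0 1) w"
      "eval2 (Q101 n k) x y = x * (1 - w) * poly (shifted_jacobi m (2 * real j + 2) 1) x *
        ((1 - x) * (1 - x) ^ j) * poly (shifted_jacobi j 1 0) w"
      using eval2_Q_blowup(8,11)[OF x, of m j w] unfolding n k y_def by simp_all
    have ev: "eval2 (Q100 n k) x y = x * poly (shifted_jacobi m (2 * real j + 3) 1) x *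
        ((1 - x) * (1 - x) ^ j) * poly (shifted_jacobi (Suc j) 0 0) w"
      "eval2 (Q100 n (k - 1)) x y = x * poly (shifted_jacobi (Suc m) (2 * real j + 1) 1) x *
        (1 - x) ^ j * poly (shifted_jacobi j 0 0) w"
      "eval2 (Q100 (n - 1) (k - 1)) x y = x * poly (shifted_jacobi m (2 * real j + 1) 1) x *
        (1 - x) ^ j * poly (shifted_jacobi j 0 0) w"
      using eval2_Q_blowup(2)[OF x, of m "Suc j" w] eval2_Q_blowup(2)[OF x, of "Suc m" j w]
        eval2_Q_blowup(2)[OF x, of m j w]
      unfolding n k y_def by (simp_all add: add.commute)
    have ev': "eval2 (if k + 1 = n then 0 else Q100 (n - 1) k) x y =
        x * (if m = 0 then 0 else poly (shifted_jacobi (m - 1) (2 * real j + 3) 1) x)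
        * ((1 - x) * (1 - x) ^ j) * poly (shifted_jacobi (Suc j) 0 0) w"
      using eval2_Q_blowup(2)[OF x, of "m - 1" "Suc j" w]
      unfolding n k y_def by (cases m) (simp_all add: add.commute)
    have nk: "real n = real m + real j + 2" "real k = real j + 1"
      by (simp_all add: n k)
    let ?f = "poly (shifted_jacobi m (2 * real j + 2) 1) x"
    \<comment> \<open>\<open>yy\<close> and \<open>z\<close> differ on the right only in the sign of
      the term of degree \<open>Suc j\<close>; this is the sign by which the two statements differ.
      The factors 1 and -1 match \<open>separated_four_term\<close>.\<close>
    have yy: "2 * (w * poly (shifted_jacobi j 0 1) w) =
        1 * (poly (shifted_jacobi j 0 0) w + 1 * poly (shifted_jacobi (Suc j) 0 0) w)"
      using shifted_jacobi_0_1_mult_x[of w j] by simp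
    have z: "2 * ((1 - w) * poly (shifted_jacobi j 1 0) w) =
        1 * (poly (shifted_jacobi j 0 0) w + (- 1) * poly (shifted_jacobi (Suc j) 0 0) w)"
      using shifted_jacobi_1_0_mult_one_minus_x[of w j] by simp
    \<comment> \<open>The term of degree \<open>Suc j\<close> in w needs the full power (1-x)^(j+1),
      so only the parameter of \<open>?f\<close> is raised, to 2j+3. The term of degree
      \<open>j\<close> needs (1-x)^j; the spare factor 1-x is absorbed in \<open>lower\<close>,
      which takes the parameter down to 2j+1.\<close>
    have raise: "2 * (real m + real j + 2) * ?f =
        (real m + 2 * real j + 4) * poly (shifted_jacobi m (2 * real j + 3) 1) x
        - (real m + 1) * (if m = 0 then 0 else poly (shifted_jacobi (m - 1) (2 * real j + 3) 1) x)"
      using shifted_jacobi_raise[of m "2 * real j + 2" 1 x]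
      by (cases m) (simp_all add: algebra_simps)
    have lower: "2 * (real m + real j + 2) * ((1 - x) * ?f) =
        (real m + 2 * real j + 2) * poly (shifted_jacobi m (2 * real j + 1) 1) x
        - (real m + 1) * poly (shifted_jacobi (Suc m) (2 * real j + 1) 1) x"
      using shifted_jacobi_mult_one_minus_x[of m "2 * real j + 2" 1 x] by (simp add: algebra_simps)
    note rel = separated_four_term[OF yy raise lower] separated_four_term[OF z raise lower]
    show "eval2 (4 * of_nat n * Q110 n k) x y = eval2 ?r1 x y"
      using arg_cong[OF rel(1), of "\<lambda>t. x * (1 - x) ^ j * t"]
      unfolding eval2_simps evQ ev ev' nk by (simp add: algebra_simps split del: if_split)
    show "eval2 (4 * of_nat n * Q101 n k) x y = eval2 ?r2 x y"
      using arg_cong[OF rel(2), of "\<lambda>t. x * (1 - x) ^ j * t"]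
      unfolding eval2_simps evQ ev ev' nk by (simp add: algebra_simps split del: if_split)
  qed
  then show "4 * of_nat n * Q110 n k = ?r1" "4 * of_nat n * Q101 n k = ?r2"
    by (blast intro: eval2_eqI)+
qed

text \<open>After the relation in w, the term of degree n-1 in w still carries (1-x)^n. Splitting
  this as (1-x)^(n-1) - x(1-x)^(n-1) gives \<open>Q100 (n - 1) (n - 1)\<close> and
  \<open>- Q100 n (n - 1)\<close>.\<close>

lemma Q110_Q100_last:
  assumes "n \<ge> 1"
  shows "2 * Q110 n n = Q100 n n - Q100 n (n - 1) + Q100 (n - 1) (n - 1)" (is "_ = ?r1")
    and "2 * Q101 n n = - Q100 n n - Q100 n (n - 1) + Q100 (n - 1) (n - 1)" (is "_ = ?r2")
proof -
  define j where "j = n - 1"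
  then have n: "n = Suc j"
    using assms by simp
  have "eval2 (2 * Q110 n n) x y = eval2 ?r1 x y" "eval2 (2 * Q101 n n) x y = eval2 ?r2 x y"
    if x: "x \<noteq> 1" and y_def: "y = (1 - x) * w" for x y w
  proof -
    have ev: "eval2 (Q110 n n) x y = w * ((1 - x) * (1 - x) ^ j) * poly (shifted_jacobi j 0 1) w"
      "eval2 (Q101 n n) x y = (1 - w) * ((1 - x) * (1 - x) ^ j) * poly (shifted_jacobi j 1 0) w"
      "eval2 (Q100 n n) x y = (1 - x) * (1 - x) ^ j * poly (shifted_jacobi (Suc j) 0 0) w"
      "eval2 (Q100 n (n - 1)) x y = x * (1 - x) ^ j * poly (shifted_jacobi j 0 0) w"
      "eval2 (Q100 (n - 1) (n - 1)) x y = (1 - x) ^ j * poly (shifted_jacobi j 0 0) w"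
      using eval2_Q_blowup(9,12,1)[OF x, of j w] eval2_Q_blowup(1)[OF x, of "Suc j" w]
        eval2_Q_blowup(2)[OF x, of 0 j w]
      unfolding n y_def by simp_all
    show "eval2 (2 * Q110 n n) x y = eval2 ?r1 x y"
      using arg_cong[OF shifted_jacobi_0_1_mult_x[of w j], of "\<lambda>t. (1 - x) * (1 - x) ^ j * t"]
      unfolding eval2_simps ev by (simp add: algebra_simps)
    show "eval2 (2 * Q101 n n) x y = eval2 ?r2 x y"
      using arg_cong[OF shifted_jacobi_1_0_mult_one_minus_x[of w j],
          of "\<lambda>t. (1 - x) * (1 - x) ^ j * t"]
      unfolding eval2_simps ev by (simp add: algebra_simps)
  qed
  then show "2 * Q110 n n = ?r1" "2 * Q101 n n = ?r2"
    by (blast intro: eval2_eqI)+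
qed

section \<open>From (1,1,0) to (0,1,0) and from (1,0,1) to (0,0,1)\<close>

lemma Q110_Q010_first:
  assumes "n \<ge> 1"
  shows "2 * Q110 n 0 = Q010 n 0 + Q010 (n - 1) 0"
    and "2 * Q101 n 0 = Q001 n 0 + Q001 (n - 1) 0"
proof -
  define j where "j = n - 1"
  then have n: "n = Suc j"
    using assms by simp
  show "2 * Q110 n 0 = Q010 n 0 + Q010 (n - 1) 0" "2 * Q101 n 0 = Q001 n 0 + Q001 (n - 1) 0"
    unfolding n using shifted_jacobi_0_1_mult_x[of _ j]
    by (auto intro!: eval2_eqI simp: Q110_def Q101_def Q010_def Q001_def)
qed

text \<open>All terms share the factor in w and the power of 1-x, so the relation for multiplication
  by x suffices.\<close>

lemma Q110_Q010_inner:
  assumes "1 \<le> k" "k < n"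
  shows "2 * of_nat n * Q110 n k = (of_nat n - of_nat k) * (Q010 n k + Q010 (n - 1) k)"
      (is "_ = ?r1")
    and "2 * of_nat n * Q101 n k = (of_nat n - of_nat k) * (Q001 n k + Q001 (n - 1) k)"
      (is "_ = ?r2")
proof -
  define j m where "j = k - 1" "m = n - k - 1"
  then have k: "k = Suc j" and n: "n = Suc (Suc (m + j))"
    using assms by simp_all
  have "eval2 (2 * of_nat n * Q110 n k) x y = eval2 ?r1 x y"
    "eval2 (2 * of_nat n * Q101 n k) x y = eval2 ?r2 x y"
    if x: "x \<noteq> 1" and y_def: "y = (1 - x) * w" for x y w
  proof -
    have ev: "eval2 (Q110 n k) x y = x * w * poly (shifted_jacobi m (2 * real j + 2) 1) x *
        ((1 - x) * (1 - x) ^ j) * poly (shifted_jacobi j 0 1) w"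
      "eval2 (Q101 n k) x y = x * (1 - w) * poly (shifted_jacobi m (2 * real j + 2) 1) x *
        ((1 - x) * (1 - x) ^ j) * poly (shifted_jacobi j 1 0) w"
      "eval2 (Q010 n k) x y = w * poly (shifted_jacobi (Suc m) (2 * real j + 2) 0) x *
        ((1 - x) * (1 - x) ^ j) * poly (shifted_jacobi j 0 1) w"
      "eval2 (Q001 n k) x y = (1 - w) * poly (shifted_jacobi (Suc m) (2 * real j + 2) 0) x *
        ((1 - x) * (1 - x) ^ j) * poly (shifted_jacobi j 1 0) w"
      "eval2 (Q010 (n - 1) k) x y = w * poly (shifted_jacobi m (2 * real j + 2) 0) x *
        ((1 - x) * (1 - x) ^ j) * poly (shifted_jacobi j 0 1) w"
      "eval2 (Q001 (n - 1) k) x y = (1 - w) * poly (shifted_jacobi m (2 * real j + 2) 0) x *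
        ((1 - x) * (1 - x) ^ j) * poly (shifted_jacobi j 1 0) w"
      using eval2_Q_blowup(4,6,8,11)[OF x, of m j w] eval2_Q_blowup(4,6)[OF x, of "Suc m" j w]
      unfolding n k y_def by simp_all
    have nk: "real n = real m + real j + 2" "real k = real j + 1"
      by (simp_all add: n k)
    have rel: "2 * (real m + real j + 2) * (x * poly (shifted_jacobi m (2 * real j + 2) 1) x) =
        (real m + 1) * (poly (shifted_jacobi (Suc m) (2 * real j + 2) 0) x
          + poly (shifted_jacobi m (2 * real j + 2) 0) x)"
      using shifted_jacobi_mult_x[of m "2 * real j + 2" 1 x] by (simp add: algebra_simps)
    show "eval2 (2 * of_nat n * Q110 n k) x y = eval2 ?r1 x y"
      using arg_cong[OF rel,
          of "\<lambda>t. w * ((1 - x) * (1 - x) ^ j) * poly (shifted_jacobi j 0 1) w * t"]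
      unfolding eval2_simps ev nk by (simp add: algebra_simps)
    show "eval2 (2 * of_nat n * Q101 n k) x y = eval2 ?r2 x y"
      using arg_cong[OF rel,
          of "\<lambda>t. (1 - w) * ((1 - x) * (1 - x) ^ j) * poly (shifted_jacobi j 1 0) w * t"]
      unfolding eval2_simps ev nk by (simp add: algebra_simps)
  qed
  then show "2 * of_nat n * Q110 n k = ?r1" "2 * of_nat n * Q101 n k = ?r2"
    by (blast intro: eval2_eqI)+
qed

lemma Q110_diag: "Q110 n n = Q010 n n" "Q101 n n = Q001 n n"
  by (cases n; simp add: Q110_def Q101_def Q010_def Q001_def in_x_def one_pCons)+

section \<open>From (0,1,1) to (0,1,0) and (0,0,1)\<close>

lemma Q011_Q010_first:
  assumes "n \<ge> 1"
  shows "2 * Q011 n 0 = - Q010 n 0 + Q010 (n - 1) 0"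
    and "2 * Q011 n 0 = - Q001 n 0 + Q001 (n - 1) 0"
proof -
  define j where "j = n - 1"
  then have n: "n = Suc j"
    using assms by simp
  show "2 * Q011 n 0 = - Q010 n 0 + Q010 (n - 1) 0" "2 * Q011 n 0 = - Q001 n 0 + Q001 (n - 1) 0"
    unfolding n using shifted_jacobi_1_0_mult_one_minus_x[of _ j]
    by (auto intro!: eval2_eqI simp: eval2_Q_blowup)
qed

text \<open>The factor 1-2w is split as 1 - 2w for the first identity and as 2(1-w) - 1 for the
  second. The part constant in w is lowered to Legendre polynomials in x, and the other part is
  raised to parameter 2.\<close>

lemma Q011_Q010_second:
  assumes "n \<ge> 1"
  shows "2 * of_nat n * Q011 n 1 =
      - 2 * (of_nat n + 1) * Q010 n 1 - of_nat n * Q010 n 0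
      + 2 * (of_nat n - 1) * Q010 (n - 1) 1 + of_nat n * Q010 (n - 1) 0" (is "_ = ?r1")
    and "2 * of_nat n * Q011 n 1 =
      2 * (of_nat n + 1) * Q001 n 1 + of_nat n * Q001 n 0
      - 2 * (of_nat n - 1) * Q001 (n - 1) 1 - of_nat n * Q001 (n - 1) 0" (is "_ = ?r2")
proof -
  define m where "m = n - 1"
  then have n: "n = Suc m"
    using assms by simp
  have "eval2 (2 * of_nat n * Q011 n 1) x y = eval2 ?r1 x y"
    "eval2 (2 * of_nat n * Q011 n 1) x y = eval2 ?r2 x y"
    if x: "x \<noteq> 1" and y_def: "y = (1 - x) * w" for x y w
  proof -
    \<comment> \<open>The value 0 at \<open>m = 0\<close>, that is n = 1, matches
      \<open>Q010 0 1 = 0\<close> and \<open>Q001 0 1 = 0\<close>.\<close>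
    define q where "q = (if m = 0 then 0 else poly (shifted_jacobi (m - 1) 2 0) x)"
    have ev: "eval2 (Q011 n 1) x y = (1 - x) * (1 - 2 * w) * poly (shifted_jacobi m 1 0) x"
      "eval2 (Q010 n 0) x y = poly (shifted_jacobi (Suc m) 0 0) x"
      "eval2 (Q001 n 0) x y = poly (shifted_jacobi (Suc m) 0 0) x"
      "eval2 (Q010 (n - 1) 0) x y = poly (shifted_jacobi m 0 0) x"
      "eval2 (Q001 (n - 1) 0) x y = poly (shifted_jacobi m 0 0) x"
      "eval2 (Q010 n 1) x y = (1 - x) * w * poly (shifted_jacobi m 2 0) x"
      "eval2 (Q001 n 1) x y = (1 - x) * (1 - w) * poly (shifted_jacobi m 2 0) x"
      using eval2_Q_blowup(14)[OF x, of m w] eval2_Q_blowup(3,5)[OF x, of "Suc m" w]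
        eval2_Q_blowup(3,5)[OF x, of m w] eval2_Q_blowup(4,6)[OF x, of m 0 w]
      unfolding n y_def by simp_all
    have ev': "eval2 (Q010 (n - 1) 1) x y = (1 - x) * w * q"
      "eval2 (Q001 (n - 1) 1) x y = (1 - x) * (1 - w) * q"
      using eval2_Q_blowup(4,6)[OF x, of "m - 1" 0 w]
      unfolding n y_def q_def by (cases m; simp add: Q010_def Q001_def)+
    have m: "real n = real m + 1"
      by (simp add: n)
    have raise: "2 * (real m + 1) * poly (shifted_jacobi m 1 0) x =
        (real m + 2) * poly (shifted_jacobi m 2 0) x - real m * q"
      using shifted_jacobi_raise[of m 1 0 x] unfolding q_def
      by (cases m) (simp_all add: algebra_simps)
    note lower = shifted_jacobi_1_0_mult_one_minus_x[of x m]
    show "eval2 (2 * of_nat n * Q011 n 1) x y = eval2 ?r1 x y"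
      using arg_cong[OF lower, of "\<lambda>t. (real m + 1) * t"]
        arg_cong[OF raise, of "\<lambda>t. 2 * w * (1 - x) * t"]
      unfolding eval2_simps ev ev' m by (simp add: algebra_simps)
    show "eval2 (2 * of_nat n * Q011 n 1) x y = eval2 ?r2 x y"
      using arg_cong[OF lower, of "\<lambda>t. (real m + 1) * t"]
        arg_cong[OF raise, of "\<lambda>t. 2 * (1 - w) * (1 - x) * t"]
      unfolding eval2_simps ev ev' m by (simp add: algebra_simps)
  qed
  then show "2 * of_nat n * Q011 n 1 = ?r1" "2 * of_nat n * Q011 n 1 = ?r2"
    by (blast intro: eval2_eqI)+
qed

text \<open>Again a two-term relation in w times two-term relations in x. One of the factors w and
  1-w stays in front, and the other is absorbed into the Jacobi polynomial with parameters (1,1);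
  this yields the coefficients 2k-1 and k-1.\<close>

lemma Q011_Q010_inner:
  assumes "2 \<le> k" "k \<le> n"
  shows "2 * of_nat n * (2 * of_nat k - 1) * Q011 n k =
      - (of_nat k - 1) * (of_nat n + of_nat k) * Q010 n k
      - (of_nat k - 1) * (of_nat n - of_nat k + 1) * Q010 n (k - 1)
      + (of_nat k - 1) * (of_nat n - of_nat k) * Q010 (n - 1) k
      + (of_nat k - 1) * (of_nat n + of_nat k - 1) * Q010 (n - 1) (k - 1)" (is "_ = ?r1")
    and "2 * of_nat n * (2 * of_nat k - 1) * Q011 n k =
      (of_nat k - 1) * (of_nat n + of_nat k) * Q001 n k
      - (of_nat k - 1) * (of_nat n - of_nat k + 1) * Q001 n (k - 1)
      - (of_nat k - 1) * (of_nat n - of_nat k) * Q001 (n - 1) k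
      + (of_nat k - 1) * (of_nat n + of_nat k - 1) * Q001 (n - 1) (k - 1)" (is "_ = ?r2")
proof -
  define j m where "j = k - 2" "m = n - k"
  then have k: "k = Suc (Suc j)" and n: "n = Suc (Suc (m + j))"
    using assms by simp_all
  have "eval2 (2 * of_nat n * (2 * of_nat k - 1) * Q011 n k) x y = eval2 ?r1 x y"
    "eval2 (2 * of_nat n * (2 * of_nat k - 1) * Q011 n k) x y = eval2 ?r2 x y"
    if x: "x \<noteq> 1" and y_def: "y = (1 - x) * w" for x y w
  proof -
    let ?f = "poly (shifted_jacobi m (2 * real j + 3) 0) x"
    define q where "q = (if m = 0 then 0 else poly (shifted_jacobi (m - 1) (2 * real j + 4) 0) x)"
    have ev: "eval2 (Q011 n k) x y = w * (1 - w) * ?f *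
        ((1 - x) * ((1 - x) * (1 - x) ^ j)) * poly (shifted_jacobi j 1 1) w"
      using eval2_Q_blowup(15)[OF x, of m j w] unfolding n k y_def by simp
    have ev1: "eval2 (Q010 n k) x y = w * poly (shifted_jacobi m (2 * real j + 4) 0) x *
        ((1 - x) * ((1 - x) * (1 - x) ^ j)) * poly (shifted_jacobi (Suc j) 0 1) w"
      "eval2 (Q010 n (k - 1)) x y = w * poly (shifted_jacobi (Suc m) (2 * real j + 2) 0) x *
        ((1 - x) * (1 - x) ^ j) * poly (shifted_jacobi j 0 1) w"
      "eval2 (Q010 (n - 1) (k - 1)) x y = w * poly (shifted_jacobi m (2 * real j + 2) 0) x *
        ((1 - x) * (1 - x) ^ j) * poly (shifted_jacobi j 0 1) w"
      "eval2 (Q001 n k) x y = (1 - w) * poly (shifted_jacobi m (2 * real j + 4) 0) x *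
        ((1 - x) * ((1 - x) * (1 - x) ^ j)) * poly (shifted_jacobi (Suc j) 1 0) w"
      "eval2 (Q001 n (k - 1)) x y = (1 - w) * poly (shifted_jacobi (Suc m) (2 * real j + 2) 0) x *
        ((1 - x) * (1 - x) ^ j) * poly (shifted_jacobi j 1 0) w"
      "eval2 (Q001 (n - 1) (k - 1)) x y = (1 - w) * poly (shifted_jacobi m (2 * real j + 2) 0) x *
        ((1 - x) * (1 - x) ^ j) * poly (shifted_jacobi j 1 0) w"
      using eval2_Q_blowup(4,6)[OF x, of m "Suc j" w] eval2_Q_blowup(4,6)[OF x, of "Suc m" j w]
        eval2_Q_blowup(4,6)[OF x, of m j w]
      unfolding n k y_def by (simp_all add: add.commute)
    \<comment> \<open>At \<open>m = 0\<close> one has k = n, so the second index exceeds the first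
      and both sides are zero.\<close>
    have ev2: "eval2 (Q010 (n - 1) k) x y = w * q *
        ((1 - x) * ((1 - x) * (1 - x) ^ j)) * poly (shifted_jacobi (Suc j) 0 1) w"
      "eval2 (Q001 (n - 1) k) x y = (1 - w) * q *
        ((1 - x) * ((1 - x) * (1 - x) ^ j)) * poly (shifted_jacobi (Suc j) 1 0) w"
      using eval2_Q_blowup(4,6)[OF x, of "m - 1" "Suc j" w]
      unfolding n k y_def q_def by (cases m; simp add: Q010_def Q001_def add.commute)+
    have nk: "real n = real m + real j + 2" "real k = real j + 2"
      by (simp_all add: n k)
    have z: "(2 * real j + 3) * ((1 - w) * poly (shifted_jacobi j 1 1) w) =
        (real j + 1) * (poly (shifted_jacobi j 0 1) w
          + (- 1) * poly (shifted_jacobi (Suc j) 0 1) w)"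
      using shifted_jacobi_mult_one_minus_x[of j 1 1 w] by (simp add: algebra_simps)
    have yy: "(2 * real j + 3) * (w * poly (shifted_jacobi j 1 1) w) =
        (real j + 1) * (poly (shifted_jacobi j 1 0) w + 1 * poly (shifted_jacobi (Suc j) 1 0) w)"
      using shifted_jacobi_mult_x[of j 1 1 w] by (simp add: algebra_simps)
    have raise: "2 * (real m + real j + 2) * ?f =
        (real m + 2 * real j + 4) * poly (shifted_jacobi m (2 * real j + 4) 0) x - real m * q"
      using shifted_jacobi_raise[of m "2 * real j + 3" 0 x] unfolding q_def
      by (cases m) (simp_all add: algebra_simps)
    have lower: "2 * (real m + real j + 2) * ((1 - x) * ?f) =
        (real m + 2 * real j + 3) * poly (shifted_jacobi m (2 * real j + 2) 0) x
        - (real m + 1) * poly (shifted_jacobi (Suc m) (2 * real j + 2) 0) x"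
      using shifted_jacobi_mult_one_minus_x[of m "2 * real j + 3" 0 x] by (simp add: algebra_simps)
    note rel = separated_four_term[OF z raise lower] separated_four_term[OF yy raise lower]
    show "eval2 (2 * of_nat n * (2 * of_nat k - 1) * Q011 n k) x y = eval2 ?r1 x y"
      using arg_cong[OF rel(1), of "\<lambda>t. w * ((1 - x) * (1 - x) ^ j) * t"]
      unfolding eval2_simps ev ev1 ev2 nk by (simp add: algebra_simps)
    show "eval2 (2 * of_nat n * (2 * of_nat k - 1) * Q011 n k) x y = eval2 ?r2 x y"
      using arg_cong[OF rel(2), of "\<lambda>t. (1 - w) * ((1 - x) * (1 - x) ^ j) * t"]
      unfolding eval2_simps ev ev1 ev2 nk by (simp add: algebra_simps)
  qed
  then show "2 * of_nat n * (2 * of_nat k - 1) * Q011 n k = ?r1"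
    "2 * of_nat n * (2 * of_nat k - 1) * Q011 n k = ?r2"
    by (blast intro: eval2_eqI)+
qed

section \<open>The six conversions together\<close>

theorem corollaryC2:
  shows
    \<comment> \<open>(1) from (1,1,0) to (1,0,0)\<close>
    "Q110 0 0 = Q100 0 0
     \<and> (\<forall>n::nat. n \<ge> 2 \<longrightarrow>
          2 * of_nat n * Q110 n 0 = (of_nat n + 1) * Q100 n 0 - of_nat n * Q100 (n - 1) 0)
     \<and> 2 * Q110 1 0 = 2 * Q100 1 0
     \<and> (\<forall>n k::nat. 1 \<le> k \<and> k + 2 \<le> n \<longrightarrow>
          4 * of_nat n * Q110 n k =
            (of_nat n + of_nat k + 1) * Q100 n k - (of_nat n - of_nat k) * Q100 n (k - 1)
            + (of_nat k - of_nat n) * Q100 (n - 1) k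
            + (of_nat n + of_nat k - 1) * Q100 (n - 1) (k - 1))
     \<and> (\<forall>n k::nat. 1 \<le> k \<and> k + 1 = n \<longrightarrow>
          4 * of_nat n * Q110 n k =
            (of_nat n + of_nat k + 1) * Q100 n k - (of_nat n - of_nat k) * Q100 n (k - 1)
            + (of_nat n + of_nat k - 1) * Q100 (n - 1) (k - 1))
     \<and> (\<forall>n::nat. n \<ge> 1 \<longrightarrow>
          2 * Q110 n n = Q100 n n - Q100 n (n - 1) + Q100 (n - 1) (n - 1))
     \<comment> \<open>(2) from (1,1,0) to (0,1,0)\<close>
     \<and> (\<forall>n::nat. n \<ge> 1 \<longrightarrow> 2 * Q110 n 0 = Q010 n 0 + Q010 (n - 1) 0)
     \<and> (\<forall>n k::nat. 1 \<le> k \<and> k + 1 \<le> n \<longrightarrow>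
          2 * of_nat n * Q110 n k = (of_nat n - of_nat k) * (Q010 n k + Q010 (n - 1) k))
     \<and> (\<forall>n::nat. Q110 n n = Q010 n n)
     \<comment> \<open>(3) from (1,0,1) to (1,0,0)\<close>
     \<and> Q101 0 0 = Q100 0 0
     \<and> (\<forall>n::nat. n \<ge> 2 \<longrightarrow>
          2 * of_nat n * Q101 n 0 = (of_nat n + 1) * Q100 n 0 - of_nat n * Q100 (n - 1) 0)
     \<and> 2 * Q101 1 0 = 2 * Q100 1 0
     \<and> (\<forall>n k::nat. 1 \<le> k \<and> k + 2 \<le> n \<longrightarrow>
          4 * of_nat n * Q101 n k =
            - (of_nat n + of_nat k + 1) * Q100 n k - (of_nat n - of_nat k) * Q100 n (k - 1)
            + (of_nat n - of_nat k) * Q100 (n - 1) k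
            + (of_nat n + of_nat k - 1) * Q100 (n - 1) (k - 1))
     \<and> (\<forall>n k::nat. 1 \<le> k \<and> k + 1 = n \<longrightarrow>
          4 * of_nat n * Q101 n k =
            - (of_nat n + of_nat k + 1) * Q100 n k - (of_nat n - of_nat k) * Q100 n (k - 1)
            + (of_nat n + of_nat k - 1) * Q100 (n - 1) (k - 1))
     \<and> (\<forall>n::nat. n \<ge> 1 \<longrightarrow>
          2 * Q101 n n = - Q100 n n - Q100 n (n - 1) + Q100 (n - 1) (n - 1))
     \<comment> \<open>(4) from (1,0,1) to (0,0,1)\<close>
     \<and> (\<forall>n::nat. n \<ge> 1 \<longrightarrow> 2 * Q101 n 0 = Q001 n 0 + Q001 (n - 1) 0)
     \<and> (\<forall>n k::nat. 1 \<le> k \<and> k + 1 \<le> n \<longrightarrow>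
          2 * of_nat n * Q101 n k = (of_nat n - of_nat k) * (Q001 n k + Q001 (n - 1) k))
     \<and> (\<forall>n::nat. Q101 n n = Q001 n n)
     \<comment> \<open>(5) from (0,1,1) to (0,1,0)\<close>
     \<and> (\<forall>n::nat. n \<ge> 1 \<longrightarrow> 2 * Q011 n 0 = - Q010 n 0 + Q010 (n - 1) 0)
     \<and> (\<forall>n::nat. n \<ge> 1 \<longrightarrow>
          2 * of_nat n * Q011 n 1 =
            - 2 * (of_nat n + 1) * Q010 n 1 - of_nat n * Q010 n 0
            + 2 * (of_nat n - 1) * Q010 (n - 1) 1 + of_nat n * Q010 (n - 1) 0)
     \<and> (\<forall>n k::nat. 2 \<le> k \<and> k \<le> n \<longrightarrow>
          2 * of_nat n * (2 * of_nat k - 1) * Q011 n k =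
            - (of_nat k - 1) * (of_nat n + of_nat k) * Q010 n k
            - (of_nat k - 1) * (of_nat n - of_nat k + 1) * Q010 n (k - 1)
            + (of_nat k - 1) * (of_nat n - of_nat k) * Q010 (n - 1) k
            + (of_nat k - 1) * (of_nat n + of_nat k - 1) * Q010 (n - 1) (k - 1))
     \<comment> \<open>(6) from (0,1,1) to (0,0,1)\<close>
     \<and> (\<forall>n::nat. n \<ge> 1 \<longrightarrow> 2 * Q011 n 0 = - Q001 n 0 + Q001 (n - 1) 0)
     \<and> (\<forall>n::nat. n \<ge> 1 \<longrightarrow>
          2 * of_nat n * Q011 n 1 =
            2 * (of_nat n + 1) * Q001 n 1 + of_nat n * Q001 n 0
            - 2 * (of_nat n - 1) * Q001 (n - 1) 1 - of_nat n * Q001 (n - 1) 0)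
     \<and> (\<forall>n k::nat. 2 \<le> k \<and> k \<le> n \<longrightarrow>
          2 * of_nat n * (2 * of_nat k - 1) * Q011 n k =
            (of_nat k - 1) * (of_nat n + of_nat k) * Q001 n k
            - (of_nat k - 1) * (of_nat n - of_nat k + 1) * Q001 n (k - 1)
            - (of_nat k - 1) * (of_nat n - of_nat k) * Q001 (n - 1) k
            + (of_nat k - 1) * (of_nat n + of_nat k - 1) * Q001 (n - 1) (k - 1))"
proof -
  have inner: "4 * of_nat n * Q110 n k =
        (of_nat n + of_nat k + 1) * Q100 n k - (of_nat n - of_nat k) * Q100 n (k - 1)
        + (of_nat k - of_nat n) * Q100 (n - 1) k
        + (of_nat n + of_nat k - 1) * Q100 (n - 1) (k - 1)"
      "4 * of_nat n * Q101 n k =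
        - (of_nat n + of_nat k + 1) * Q100 n k - (of_nat n - of_nat k) * Q100 n (k - 1)
        + (of_nat n - of_nat k) * Q100 (n - 1) k
        + (of_nat n + of_nat k - 1) * Q100 (n - 1) (k - 1)" if "1 \<le> k" "k + 2 \<le> n" for n k
    using Q110_Q100_inner[of k n] that by simp_all
  have border: "4 * of_nat n * Q110 n k =
        (of_nat n + of_nat k + 1) * Q100 n k - (of_nat n - of_nat k) * Q100 n (k - 1)
        + (of_nat n + of_nat k - 1) * Q100 (n - 1) (k - 1)"
      "4 * of_nat n * Q101 n k =
        - (of_nat n + of_nat k + 1) * Q100 n k - (of_nat n - of_nat k) * Q100 n (k - 1)
        + (of_nat n + of_nat k - 1) * Q100 (n - 1) (k - 1)" if "1 \<le> k" "k + 1 = n" for n k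
    using Q110_Q100_inner[of k n] that by simp_all
  \<comment> \<open>At n = 1 each side is 2x; there is no term from n-1, since x times a polynomial
    of degree -1 is read as zero.\<close>
  have small: "Q110 0 0 = Q100 0 0" "Q101 0 0 = Q100 0 0"
      "2 * Q110 1 0 = 2 * Q100 1 0" "2 * Q101 1 0 = 2 * Q100 1 0"
    by (simp_all add: Q110_def Q101_def Q100_def tri_P_def homog_def in_x_def one_pCons)
  have less: "k < n" if "k + 1 \<le> n" for k n :: nat
    using that by simp
  show ?thesis
    by (intro conjI allI impI; (elim conjE)?;
      (rule inner border small Q110_Q100_first Q110_Q100_last Q110_Q010_first Q110_Q010_inner
        Q110_diag Q011_Q010_first Q011_Q010_second Q011_Q010_inner); (assumption | erule less))
qed

end
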